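(* Let $G$ be a finite simple graph and let $\hat G$ be the graph obtained from $G$ by the following procedure: set $\hat G:=G$; while $\hat G$ has a leaf $u$ (with neighbor $v$), replace $\hat G$ by $\hat G-\{u,v\}$; then output $\hat G$ (so $\hat G$ has no vertex of degree one, or has no vertices). Then (i) $Z^-(G)=Z^-(\hat G)$, and (ii) $Z^-(G)=0$ if and only if $\hat G$ is the graph with no vertices.
   Context: Skew zero forcing: initially some set of vertices is colored blue and the rest white; the rule is: if $w$ is the only white neighbor of any vertex $u$ (blue or white), then $u$ may color $w$ blue. A skew zero forcing set is an initial blue set from which repeated application can make all vertices blue; $Z^-(G)$ is the minimum cardinality of a skew zero forcing set. A leaf is a vertex of degree one. $G-S$ denotes the subgraph induced by $V(G)\setminus S$. By convention $Z^-$ of the graph with no vertices is $0$. The choice of leaf at each iteration is arbitrary; the statement holds for any output of the procedure. *)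

theory Defs
  imports "Graph_Theory.Digraph_Component"
begin

text \<open>
  Finite simple graphs are the locale \<^locale>\<open>graph\<close> of the AFP entry Graph_Theory: finite,
  symmetric digraphs without loops and parallel arcs. Each edge is a pair of opposite arcs, so
  \<open>u \<rightarrow>\<^bsub>G\<^esub> v\<close> is adjacency and \<^const>\<open>out_degree\<close> is the degree.
\<close>

definition neighbors :: "('a, 'b) pre_digraph \<Rightarrow> 'a \<Rightarrow> 'a set" where
  "neighbors G u = {w. u \<rightarrow>\<^bsub>G\<^esub> w}"

definition delete_verts :: "('a, 'b) pre_digraph \<Rightarrow> 'a set \<Rightarrow> ('a, 'b) pre_digraph" where
  "delete_verts G S = G \<restriction> (verts G - S)"

definition leaf :: "('a, 'b) pre_digraph \<Rightarrow> 'a \<Rightarrow> bool" where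
  "leaf G u \<longleftrightarrow> u \<in> verts G \<and> out_degree G u = 1"

text \<open>
  One application of the color change rule, as a relation between sets of blue vertices. The
  forcing vertex \<open>u\<close> need not be blue; this is what distinguishes skew from standard zero forcing.
\<close>
inductive skew_force :: "('a, 'b) pre_digraph \<Rightarrow> 'a set \<Rightarrow> 'a set \<Rightarrow> bool"
  for G :: "('a, 'b) pre_digraph" where
  "u \<in> verts G \<Longrightarrow> neighbors G u - B = {w} \<Longrightarrow> skew_force G B (insert w B)"

definition skew_zero_forcing_set :: "('a, 'b) pre_digraph \<Rightarrow> 'a set \<Rightarrow> bool" where
  "skew_zero_forcing_set G B \<longleftrightarrow> B \<subseteq> verts G \<and> (skew_force G)\<^sup>*\<^sup>* B (verts G)"

text \<open>
  The \<open>LEAST\<close> is over a nonempty set of numbers, since \<open>verts G\<close> is itself a forcing set.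
\<close>
definition skew_zero_forcing_number :: "('a, 'b) pre_digraph \<Rightarrow> nat" where
  "skew_zero_forcing_number G = (LEAST k. \<exists>B. skew_zero_forcing_set G B \<and> card B = k)"

inductive leaf_strip_step :: "('a, 'b) pre_digraph \<Rightarrow> ('a, 'b) pre_digraph \<Rightarrow> bool" where
  "leaf G u \<Longrightarrow> v \<in> neighbors G u \<Longrightarrow> leaf_strip_step G (delete_verts G {u, v})"

text \<open>
  The choice of leaf in each iteration is arbitrary, so the procedure is a relation: \<open>H\<close> is an
  output for the input \<open>G\<close> if some run leads from \<open>G\<close> to \<open>H\<close> and stops there.
\<close>
definition leaf_strip_output :: "('a, 'b) pre_digraph \<Rightarrow> ('a, 'b) pre_digraph \<Rightarrow> bool" where
  "leaf_strip_output G H \<longleftrightarrow> leaf_strip_step\<^sup>*\<^sup>* G H \<and> \<not> (\<exists>u. leaf H u)"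

lemma skew_zero_forcing_number_attained:
  "\<exists>B. skew_zero_forcing_set G B \<and> card B = skew_zero_forcing_number G"
proof -
  have "\<exists>k B. skew_zero_forcing_set G B \<and> card B = k"
    by (auto simp: skew_zero_forcing_set_def)
  then show ?thesis
    unfolding skew_zero_forcing_number_def by (rule LeastI_ex)
qed

lemma skew_zero_forcing_number_le:
  "skew_zero_forcing_set G B \<Longrightarrow> skew_zero_forcing_number G \<le> card B"
  unfolding skew_zero_forcing_number_def by (rule Least_le) blast

lemma skew_zero_forcing_number_no_verts:
  "verts G = {} \<Longrightarrow> skew_zero_forcing_number G = 0"
  using skew_zero_forcing_number_attained[of G] by (auto simp: skew_zero_forcing_set_def)

lemma graph_delete_verts:
  assumes "graph G"
  shows "graph (delete_verts G S)"
proof -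
  interpret graph G by fact
  have "symmetric (delete_verts G S)"
    using sym_arcs unfolding symmetric_def delete_verts_def sym_def
    by (fastforce simp: arcs_ends_def arc_to_ends_def image_iff)
  then show ?thesis
    by unfold_locales
      (auto simp: delete_verts_def arc_to_ends_def dest: no_loops intro: no_multi_arcs)
qed

lemma leaf_strip_output_exists:
  assumes "graph G"
  shows "\<exists>H. leaf_strip_output G H"
  using assms
proof (induction "card (verts G)" arbitrary: G rule: less_induct)
  case less
  interpret graph G by (rule less.prems)
  show ?case
  proof (cases "\<exists>u. leaf G u")
    case True
    then obtain u where u: "leaf G u" ..
    then have "out_arcs G u \<noteq> {}"
      by (auto simp: leaf_def out_degree_def)
    then obtain e where "e \<in> arcs G" "tail G e = u"
      by (metis ex_in_conv in_out_arcs_conv)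
    then have "head G e \<in> neighbors G u"
      by (auto simp: neighbors_def arcs_ends_def arc_to_ends_def)
    with u have step: "leaf_strip_step G (delete_verts G {u, head G e})"
      by (rule leaf_strip_step.intros)
    have "verts (delete_verts G {u, head G e}) \<subset> verts G"
      using u by (auto simp: delete_verts_def leaf_def)
    then have "card (verts (delete_verts G {u, head G e})) < card (verts G)"
      by (simp add: psubset_card_mono)
    then obtain H where "leaf_strip_output (delete_verts G {u, head G e}) H"
      using less.hyps less.prems graph_delete_verts by blast
    with step show ?thesis
      unfolding leaf_strip_output_def by (meson converse_rtranclp_into_rtranclp)
  next
    case False
    then show ?thesis
      unfolding leaf_strip_output_def by blast
  qed
qed

end

theory Submission
  imports Defs
begin

text \<open>
  Call a vertex set stalled if it admits no force. A set forces the whole graph iff the only stalled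
  set above it is the full vertex set, so forcing sequences need not be handled any further.
  Let \<open>u\<close> be a leaf with neighbor \<open>v\<close>. A force out of \<open>v\<close> onto a vertex \<open>w \<noteq> u\<close> needs
  \<open>u\<close> to be blue from the start, as only \<open>v\<close> can force \<open>u\<close>; hence trading \<open>u\<close> for
  \<open>w\<close> in a forcing set of \<open>G\<close> costs nothing in \<open>G - {u, v}\<close>. Conversely, in \<open>G\<close> the
  leaf forces \<open>v\<close>, and \<open>v\<close> forces the leaf at the end. In a leafless graph the empty set is
  stalled.
\<close>

section \<open>Stalled sets as barriers to forcing\<close>

definition stalled :: "('a, 'b) pre_digraph \<Rightarrow> 'a set \<Rightarrow> bool" where
  "stalled G S \<longleftrightarrow> (\<forall>x\<in>verts G. \<forall>w. neighbors G x - S \<noteq> {w})"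

lemma stalledI:
  assumes "\<And>x w. x \<in> verts G \<Longrightarrow> neighbors G x - S = {w} \<Longrightarrow> False"
  shows "stalled G S"
  using assms unfolding stalled_def by blast

lemma stalledD:
  assumes "stalled G S" "x \<in> verts G"
  shows "neighbors G x - S \<noteq> {w}"
  using assms unfolding stalled_def by blast

text \<open>A first force leaving \<open>S\<close> would color some \<open>w\<close> outside
  \<open>S\<close> that is the only neighbor of \<open>x\<close> outside \<open>C\<close>. As
  \<open>C \<subseteq> S\<close>, it would also be the only one outside \<open>S\<close>, so
  \<open>x\<close> could force over \<open>S\<close>.\<close>

lemma skew_force_rtranclp_subset_stalled:
  assumes "(skew_force G)\<^sup>*\<^sup>* B C" "stalled G S" "B \<subseteq> S"
  shows "C \<subseteq> S"
  using assms(1)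
proof induction
  case base
  show ?case by fact
next
  case (step C D)
  from step.hyps(2) obtain x w where
    x: "x \<in> verts G" "neighbors G x - C = {w}" and D: "D = insert w C"
    by cases
  have "w \<in> S"
  proof (rule ccontr)
    assume "w \<notin> S"
    with x(2) step.IH have "neighbors G x - S = {w}" by blast
    with stalledD[OF assms(2) x(1)] show False by blast
  qed
  with D step.IH show ?case by simp
qed

lemma skew_force_rtranclp_increasing: "(skew_force G)\<^sup>*\<^sup>* B C \<Longrightarrow> B \<subseteq> C"
  by (induction rule: rtranclp_induct) (auto simp: skew_force.simps)

section \<open>Neighborhoods and forcing in a finite simple graph\<close>

context graph
begin

lemma neighbors_subset_verts: "neighbors G x \<subseteq> verts G"
  by (auto simp: neighbors_def)

lemma neighbors_sym: "y \<in> neighbors G x \<longleftrightarrow> x \<in> neighbors G y"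
  unfolding neighbors_def using graph_symmetric by blast

lemma not_in_own_neighbors: "x \<notin> neighbors G x"
  by (auto simp: neighbors_def dest: adj_not_same)

text \<open>\<open>out_degree\<close> counts arcs; since there are no parallel arcs,
  \<open>head G\<close> is injective on the arcs leaving \<open>x\<close>.\<close>

lemma card_neighbors: "card (neighbors G x) = out_degree G x"
proof -
  have "neighbors G x = head G ` out_arcs G x"
    by (force simp: neighbors_def arcs_ends_def arc_to_ends_def)
  moreover have "inj_on (head G) (out_arcs G x)"
    by (rule inj_onI) (auto intro: no_multi_arcs simp: arc_to_ends_def)
  ultimately show ?thesis
    by (simp add: card_image out_degree_def)
qed

lemma neighbors_delete_verts:
  assumes "x \<in> verts G - S"
  shows "neighbors (delete_verts G S) x = neighbors G x - S"
  using assms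
  by (fastforce simp: neighbors_def delete_verts_def arcs_ends_def arc_to_ends_def)

text \<open>Each force lowers the number of white vertices, so forcing as long as possible
  terminates. As forcing never leaves a stalled superset, the result is the least stalled superset
  of \<open>B\<close>.\<close>

lemma skew_force_reaches_stalled:
  assumes "B \<subseteq> verts G"
  shows "\<exists>S. (skew_force G)\<^sup>*\<^sup>* B S \<and> S \<subseteq> verts G \<and> stalled G S"
  using assms
proof (induction "card (verts G - B)" arbitrary: B rule: less_induct)
  case less
  show ?case
  proof (cases "stalled G B")
    case True
    with less.prems show ?thesis by blast
  next
    case False
    then obtain x w where x: "x \<in> verts G" and w: "neighbors G x - B = {w}"
      unfolding stalled_def by blast
    have force: "skew_force G B (insert w B)"
      using x w by (rule skew_force.intros)
    have w_in: "w \<in> verts G" "w \<notin> B"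
      using w neighbors_subset_verts by blast+
    then have "card (verts G - insert w B) < card (verts G - B)"
      by (intro psubset_card_mono) auto
    with less.hyps less.prems w_in obtain S where
      "(skew_force G)\<^sup>*\<^sup>* (insert w B) S" "S \<subseteq> verts G" "stalled G S"
      by blast
    with force show ?thesis
      by (meson converse_rtranclp_into_rtranclp)
  qed
qed

lemma skew_zero_forcing_set_iff_stalled:
  "skew_zero_forcing_set G B \<longleftrightarrow>
    B \<subseteq> verts G \<and> (\<forall>S. B \<subseteq> S \<longrightarrow> S \<subseteq> verts G \<longrightarrow> stalled G S \<longrightarrow> S = verts G)"
proof
  assume "skew_zero_forcing_set G B"
  then show "B \<subseteq> verts G \<and> (\<forall>S. B \<subseteq> S \<longrightarrow> S \<subseteq> verts G \<longrightarrow> stalled G S \<longrightarrow> S = verts G)"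
    unfolding skew_zero_forcing_set_def
    using skew_force_rtranclp_subset_stalled by blast
next
  assume R: "B \<subseteq> verts G \<and> (\<forall>S. B \<subseteq> S \<longrightarrow> S \<subseteq> verts G \<longrightarrow> stalled G S \<longrightarrow> S = verts G)"
  obtain S where S: "(skew_force G)\<^sup>*\<^sup>* B S" "S \<subseteq> verts G" "stalled G S"
    using skew_force_reaches_stalled[OF conjunct1[OF R]] by blast
  from R S(2,3) skew_force_rtranclp_increasing[OF S(1)] have "S = verts G"
    by blast
  with R S(1) show "skew_zero_forcing_set G B"
    unfolding skew_zero_forcing_set_def by simp
qed

section \<open>Deleting a leaf together with its neighbor\<close>

lemma leaf_neighbors:
  assumes "leaf G u" "v \<in> neighbors G u"
  shows "neighbors G u = {v}"
  using assms card_neighbors[of u] by (auto simp: leaf_def card_1_singleton_iff)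

context
  fixes u v
  assumes leaf: "leaf G u" and v: "v \<in> neighbors G u"
begin

private abbreviation "G' \<equiv> delete_verts G {u, v}"

private lemma leaf_facts:
  shows "u \<in> verts G" "v \<in> verts G" "u \<noteq> v" "u \<in> neighbors G v"
    and "verts G' = verts G - {u, v}"
proof -
  show "u \<in> verts G" "verts G' = verts G - {u, v}"
    using leaf by (auto simp: leaf_def delete_verts_def)
  show "v \<in> verts G" "u \<noteq> v" "u \<in> neighbors G v"
    using v neighbors_subset_verts not_in_own_neighbors neighbors_sym by blast+
qed

private lemma graph_G': "graph G'"
  by (rule graph_delete_verts) (rule graph_axioms)

private lemma leaf_notin_neighbors: "x \<noteq> v \<Longrightarrow> u \<notin> neighbors G x"
  using leaf_neighbors[OF leaf v] neighbors_sym by blast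

private lemma neighbors_diff:
  assumes "x \<in> verts G'" "v \<in> T"
  shows "neighbors G x - T = neighbors G' x - T"
  using assms leaf_notin_neighbors leaf_facts(5) neighbors_delete_verts[of x "{u, v}"] by auto

text \<open>With \<open>v\<close> blue, the leaf has no white neighbor, and a vertex other than
  \<open>u\<close> and \<open>v\<close> has the same white neighbors in both graphs. Only forces out
  of \<open>v\<close> remain to be excluded.\<close>

lemma stalled_delete_leaf_pair_iff:
  assumes "v \<in> T"
  shows "stalled G T \<longleftrightarrow>
    stalled (delete_verts G {u, v}) (T - {u, v}) \<and> (\<forall>w. neighbors G v - T \<noteq> {w})"
proof -
  have "neighbors G' x - (T - {u, v}) = neighbors G' x - T" for x
    using graph.neighbors_subset_verts[OF graph_G', of x] leaf_facts(5) by blast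
  moreover have "neighbors G u - T = {}"
    using leaf_neighbors[OF leaf v] assms by auto
  moreover have "verts G = insert u (insert v (verts G'))"
    using leaf_facts by auto
  ultimately show ?thesis
    using neighbors_diff[OF _ assms] unfolding stalled_def by auto
qed

lemma skew_zero_forcing_set_insert_leaf_pair:
  assumes "skew_zero_forcing_set (delete_verts G {u, v}) B"
  shows "skew_zero_forcing_set G B"
  unfolding skew_zero_forcing_set_iff_stalled
proof (intro conjI allI impI)
  note B = assms[unfolded graph.skew_zero_forcing_set_iff_stalled[OF graph_G']]
  then show "B \<subseteq> verts G"
    using leaf_facts(5) by blast
  fix S
  assume S: "B \<subseteq> S" "S \<subseteq> verts G" "stalled G S"
  \<comment> \<open>Otherwise the leaf could force \<open>v\<close>.\<close>
  have vS: "v \<in> S"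
    using stalledD[OF S(3) leaf_facts(1), of v] leaf_neighbors[OF leaf v] by auto
  with S(3) have "stalled G' (S - {u, v})" and no_force: "\<forall>w. neighbors G v - S \<noteq> {w}"
    by (auto simp: stalled_delete_leaf_pair_iff)
  moreover have "B \<subseteq> S - {u, v}" "S - {u, v} \<subseteq> verts G'"
    using S B leaf_facts(5) by auto
  ultimately have "S - {u, v} = verts G'"
    using B by blast
  then have sup: "verts G - {u, v} \<subseteq> S"
    using leaf_facts(5) by auto
  have "u \<in> S"
  proof (rule ccontr)
    assume "u \<notin> S"
    then have "neighbors G v - S = {u}"
      using sup vS leaf_facts(4) neighbors_subset_verts by blast
    with no_force show False by blast
  qed
  with vS sup S(2) show "S = verts G" by blast
qed

lemma skew_zero_forcing_set_delete_leaf_pair: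
  assumes "skew_zero_forcing_set G B"
  shows "\<exists>B'. skew_zero_forcing_set (delete_verts G {u, v}) B' \<and> card B' \<le> card B"
proof -
  note B = assms[unfolded skew_zero_forcing_set_iff_stalled]
  define B0 where "B0 = B - {u, v}"
  have finB: "finite B"
    using B finite_subset finite_verts by blast
  have B0: "B0 \<subseteq> verts G'"
    using B leaf_facts(5) unfolding B0_def by blast
  \<comment> \<open>A stalled set of \<open>G'\<close> is lifted to a set \<open>T\<close> of
    \<open>G\<close> in which only \<open>v\<close> might force. The lifts used below are
    \<open>S \<union> {u, v}\<close> and, if \<open>u \<notin> B\<close>, also
    \<open>S \<union> {v}\<close>.\<close>
  have full: "S = verts G'"
    if S: "B0 \<subseteq> S" "S \<subseteq> verts G'" "stalled G' S"
      and T: "B \<subseteq> T" "v \<in> T" "T \<subseteq> verts G" "T - {u, v} = S"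
      and no_force: "\<forall>w. neighbors G v - T \<noteq> {w}" for S T
  proof -
    have "stalled G T"
      using T S no_force by (simp add: stalled_delete_leaf_pair_iff)
    with T B have "T = verts G" by blast
    with T(4) leaf_facts(5) show ?thesis by simp
  qed
  have full_both: "S = verts G'"
    if S: "B0 \<subseteq> S" "S \<subseteq> verts G'" "stalled G' S"
      and no_force: "\<forall>w. neighbors G v - (S \<union> {u, v}) \<noteq> {w}" for S
  proof (rule full[OF S _ _ _ _ no_force])
    show "B \<subseteq> S \<union> {u, v}"
      using S(1) unfolding B0_def by blast
  qed (use S(2) leaf_facts(1,2,5) in auto)
  show ?thesis
  proof (cases "u \<in> B")
    case False
    have "S = verts G'" if S: "B0 \<subseteq> S" "S \<subseteq> verts G'" "stalled G' S" for S
    proof (cases "neighbors G v \<subseteq> S \<union> {u, v}")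
      case True
      show ?thesis
        by (rule full_both[OF S]) (metis True Diff_eq_empty_iff insert_not_empty)
    next
      \<comment> \<open>Leaving \<open>u\<close> white in the lift gives \<open>v\<close> the two
        white neighbors \<open>u\<close> and \<open>y\<close>, so \<open>v\<close> cannot
        force.\<close>
      case nsub: False
      then obtain y where "y \<in> neighbors G v - (S \<union> {v})" "y \<noteq> u"
        by blast
      moreover have "u \<in> neighbors G v - (S \<union> {v})"
        using leaf_facts S(2) by auto
      ultimately have "\<forall>w. neighbors G v - (S \<union> {v}) \<noteq> {w}"
        by (metis singletonD)
      moreover have "B \<subseteq> S \<union> {v}"
        using S(1) False unfolding B0_def by blast
      moreover have "S \<union> {v} \<subseteq> verts G" "S \<union> {v} - {u, v} = S"
        using S(2) leaf_facts(2,5) by auto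
      ultimately show ?thesis
        by (intro full[OF S, of "S \<union> {v}"]) blast+
    qed
    with B0 have "skew_zero_forcing_set G' B0"
      unfolding graph.skew_zero_forcing_set_iff_stalled[OF graph_G'] by blast
    moreover have "card B0 \<le> card B"
      unfolding B0_def by (rule card_mono[OF finB]) auto
    ultimately show ?thesis by blast
  next
    case True
    \<comment> \<open>The strict inequality leaves room for one extra vertex in place of
      \<open>u\<close>.\<close>
    have card_B0: "card B0 < card B"
      unfolding B0_def by (rule psubset_card_mono[OF finB]) (use True in auto)
    \<comment> \<open>\<open>S0\<close> is the closure of \<open>B0\<close> under forcing in
      \<open>G'\<close>; it determines whether an extra vertex is needed and which one.\<close>
    obtain S0 where S0: "(skew_force G')\<^sup>*\<^sup>* B0 S0" "S0 \<subseteq> verts G'" "stalled G' S0"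
      using graph.skew_force_reaches_stalled[OF graph_G' B0] by blast
    have S0_least: "S0 \<subseteq> S" if "B0 \<subseteq> S" "stalled G' S" for S
      using skew_force_rtranclp_subset_stalled[OF S0(1)] that by blast
    show ?thesis
    proof (cases "\<exists>w. neighbors G v - (S0 \<union> {u, v}) = {w}")
      case True
      \<comment> \<open>In \<open>G\<close>, once \<open>S0\<close>, \<open>u\<close> and
        \<open>v\<close> are blue, \<open>v\<close> forces \<open>w\<close>. No such force exists in
        \<open>G'\<close>, so \<open>w\<close> is made blue from the start.\<close>
      then obtain w where w: "neighbors G v - (S0 \<union> {u, v}) = {w}" ..
      have "w \<in> verts G'"
        using w neighbors_subset_verts leaf_facts(5) by blast
      moreover have "S = verts G'"
        if S: "insert w B0 \<subseteq> S" "S \<subseteq> verts G'" "stalled G' S" for S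
      proof (rule full_both)
        \<comment> \<open>\<open>S\<close> contains \<open>S0\<close> by leastness and
          \<open>w\<close> by assumption, hence every neighbor of \<open>v\<close> other than
          \<open>u\<close>.\<close>
        have "neighbors G v - (S \<union> {u, v}) = {}"
          using w S0_least[of S] S by blast
        then show "\<forall>w. neighbors G v - (S \<union> {u, v}) \<noteq> {w}"
          by (metis insert_not_empty)
      qed (use S in auto)
      ultimately have "skew_zero_forcing_set G' (insert w B0)"
        unfolding graph.skew_zero_forcing_set_iff_stalled[OF graph_G'] using B0 by blast
      moreover have "card (insert w B0) \<le> card B"
        using card_B0 card_insert_le_m1[of "card B" B0 w] by linarith
      ultimately show ?thesis by blast
    next
      case False
      have B0_S0: "B0 \<subseteq> S0"
        using S0(1) by (rule skew_force_rtranclp_increasing)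
      \<comment> \<open>Here \<open>v\<close> has no force over the lift of \<open>S0\<close>, so
        the closure itself is already everything.\<close>
      with False S0 B0_S0 have "S0 = verts G'"
        using full_both by blast
      with S0(1) B0 have "skew_zero_forcing_set G' B0"
        unfolding skew_zero_forcing_set_def by simp
      with card_B0 show ?thesis by (meson less_imp_le)
    qed
  qed
qed

lemma skew_zero_forcing_number_delete_leaf_pair:
  "skew_zero_forcing_number (delete_verts G {u, v}) = skew_zero_forcing_number G"
proof (rule antisym)
  obtain B where "skew_zero_forcing_set G B" "card B = skew_zero_forcing_number G"
    using skew_zero_forcing_number_attained by blast
  then show "skew_zero_forcing_number G' \<le> skew_zero_forcing_number G"
    using skew_zero_forcing_set_delete_leaf_pair skew_zero_forcing_number_le
    by (metis order_trans)
next
  obtain B where "skew_zero_forcing_set G' B" "card B = skew_zero_forcing_number G'"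
    using skew_zero_forcing_number_attained by blast
  then show "skew_zero_forcing_number G \<le> skew_zero_forcing_number G'"
    using skew_zero_forcing_set_insert_leaf_pair skew_zero_forcing_number_le by metis
qed

end

section \<open>Leafless graphs and runs of the procedure\<close>

lemma leafless_skew_zero_forcing_number_eq_0_iff:
  assumes "\<not> (\<exists>u. leaf G u)"
  shows "skew_zero_forcing_number G = 0 \<longleftrightarrow> verts G = {}"
proof
  assume "skew_zero_forcing_number G = 0"
  then obtain B where B: "skew_zero_forcing_set G B" "card B = 0"
    using skew_zero_forcing_number_attained by metis
  then have "B = {}"
    using finite_subset[OF _ finite_verts] by (auto simp: skew_zero_forcing_set_def)
  \<comment> \<open>With all vertices white, a force needs a vertex with exactly one neighbor, that
    is, a leaf.\<close>
  moreover have "stalled G {}"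
    using assms by (intro stalledI) (auto simp: leaf_def simp flip: card_neighbors)
  ultimately show "verts G = {}"
    using B(1) unfolding skew_zero_forcing_set_iff_stalled by blast
qed (rule skew_zero_forcing_number_no_verts)

end

lemma leaf_strip_step_rtranclp_invariant:
  assumes "leaf_strip_step\<^sup>*\<^sup>* G H" "graph G"
  shows "graph H \<and> skew_zero_forcing_number H = skew_zero_forcing_number G"
  using assms(1)
proof induction
  case base
  with assms(2) show ?case by simp
next
  case (step H K)
  from step.hyps(2) show ?case
    by cases (use step.IH graph_delete_verts graph.skew_zero_forcing_number_delete_leaf_pair in metis)
qed

theorem theorem3p22:
  fixes G H :: "('a, 'b) pre_digraph"
  assumes "graph G"
    and "leaf_strip_output G H"
  shows "skew_zero_forcing_number G = skew_zero_forcing_number H \<and>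
    (skew_zero_forcing_number G = 0 \<longleftrightarrow> verts H = {})"
proof -
  have "graph H" and eq: "skew_zero_forcing_number H = skew_zero_forcing_number G"
    using assms leaf_strip_step_rtranclp_invariant unfolding leaf_strip_output_def by blast+
  moreover have "\<not> (\<exists>u. leaf H u)"
    using assms(2) by (simp add: leaf_strip_output_def)
  ultimately show ?thesis
    using graph.leafless_skew_zero_forcing_number_eq_0_iff by metis
qed

end
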